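(* Let $\Xi=\{0,1\}^{\mathbb{Z}}$ and let $c:\mathbb{Z}\times\Xi\to[0,\infty)$ be bounded, translation invariant and of finite range, and suppose that the one-dimensional spin system with flip rates $c(x,\eta)$ is attractive. Let $(\bar{\xi}_t)_{t\ge 0}$ be this spin system started from the deterministic initial configuration $\bar{\xi}_0=1_{(-\infty,0]}$, i.e. $\bar{\xi}_0(x)=1$ if $x\le 0$ and $\bar{\xi}_0(x)=0$ if $x>0$. For $t\ge 0$ and an integer $z\ge 0$, let $\mu_t(z)$ denote the joint law of $(\bar{\xi}_t(z),\bar{\xi}_t(z+1),\bar{\xi}_t(z+2),\dots)$, a probability measure on $\Xi^{+}=\{0,1\}^{\{0,1,2,\dots\}}$. Then for every $t\ge 0$ the collection $(\mu_t(z): z\ge 0)$ is decreasing, that is, $\mu_t(z)\ge\mu_t(z+1)$ in the stochastic order on probability measures on $\Xi^{+}$ for all integers $z\ge 0$.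
   Context: $\Xi=\{0,1\}^{\mathbb{Z}}$ carries the product topology and the coordinatewise partial order ($\eta\le\zeta$ iff $\eta(x)\le\zeta(x)$ for all $x$); likewise for $\Xi^{+}=\{0,1\}^{\{0,1,2,\dots\}}$. Translation invariance: $c(x,\eta)=c(0,\tau_x\eta)$ for all $x\in\mathbb{Z}$, $\eta\in\Xi$, where $(\tau_x\eta)(y)=\eta(x+y)$. Finite range: $c(x,\eta)$ depends on $\eta$ only through $\eta(x)$ and a finite number of other coordinates of $\eta$. Spin system: the one-dimensional spin system with flip rates $c(x,\eta)$ is the Feller process on $\Xi$ whose generator is (the closure of) the operator $\mathcal{L}$ given by $$\mathcal{L}f(\eta)=\sum_{x\in\mathbb{Z}}c(x,\eta)\bigl(f(\eta_x)-f(\eta)\bigr)$$ for functions $f$ depending on finitely many coordinates, where $\eta_x(x)=1-\eta(x)$ and $\eta_x(y)=\eta(y)$ for $y\ne x$. When $c$ is non-negative, bounded, translation invariant and of finite range, this process exists and is unique. Its semigroup is denoted $S(t)$, and for a probability measure $\mu$ on $\Xi$, $\mu S(t)$ is the law at time $t$ of the process started from initial law $\mu$. Stochastic order: for probability measures $\mu,\nu$ on $\Xi$ (respectively on $\Xi^{+}$), $\mu\le\nu$ (equivalently $\nu\ge\mu$) means $\int f\,d\mu\le\int f\,d\nu$ for all bounded (measurable) functions $f$ that are increasing with respect to the coordinatewise partial order. Attractiveness: the process is attractive if $\mu_1\le\mu_2$ implies $\mu_1S(t)\le\mu_2S(t)$ for all $t\ge 0$. A known necessary and sufficient condition is: whenever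 $\eta\le\zeta$, if $\eta(x)=\zeta(x)=0$ then $c(x,\eta)\le c(x,\zeta)$, and if $\eta(x)=\zeta(x)=1$ then $c(x,\eta)\ge c(x,\zeta)$. Decreasing: a collection $(\nu_n:n\ge 0)$ of probability measures on $\Xi^{+}$ is decreasing if $\nu_n\ge\nu_{n+1}$ for all $n\ge 0$. *)

theory Defs
  imports "HOL-Probability.Probability"
begin

text \<open>Configurations in \<open>{0,1}\<^sup>S\<close> are functions into \<^typ>\<open>bool\<close> (\<^const>\<open>True\<close> is 1); the library's
  topology, order and Borel sigma-algebra on function types are the product topology, the
  coordinatewise order and the Borel sigma-algebra of the product topology.\<close>

type_synonym config = "int \<Rightarrow> bool"

definition shift :: "int \<Rightarrow> config \<Rightarrow> config" where
  "shift x \<eta> = (\<lambda>y. \<eta> (x + y))"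

definition flip :: "int \<Rightarrow> config \<Rightarrow> config" where
  "flip x \<eta> = \<eta>(x := \<not> \<eta> x)"

definition translation_invariant :: "(int \<Rightarrow> config \<Rightarrow> real) \<Rightarrow> bool" where
  "translation_invariant c \<longleftrightarrow> (\<forall>x \<eta>. c x \<eta> = c 0 (shift x \<eta>))"

definition finite_range :: "(int \<Rightarrow> config \<Rightarrow> real) \<Rightarrow> bool" where
  "finite_range c \<longleftrightarrow>
    (\<forall>x. \<exists>N. finite N \<and> (\<forall>\<eta> \<zeta>. (\<forall>y\<in>insert x N. \<eta> y = \<zeta> y) \<longrightarrow> c x \<eta> = c x \<zeta>))"

definition bounded_rates :: "(int \<Rightarrow> config \<Rightarrow> real) \<Rightarrow> bool" where
  "bounded_rates c \<longleftrightarrow> (\<exists>K. \<forall>x \<eta>. c x \<eta> \<le> K)"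

text \<open>\<open>P t \<eta>\<close> is the law at time \<open>t \<ge> 0\<close> of the process started from \<open>\<eta>\<close>; values of \<open>P\<close> and of
  processes at negative times are irrelevant. The state space is meant to be compact, so that
  \<^typ>\<open>'a \<Rightarrow>\<^sub>C real\<close> is the space of all continuous functions with the supremum norm.\<close>

definition feller_kernel :: "(real \<Rightarrow> 'a::topological_space \<Rightarrow> 'a measure) \<Rightarrow> bool" where
  "feller_kernel P \<longleftrightarrow>
    (\<forall>t\<ge>0. P t \<in> borel \<rightarrow>\<^sub>M prob_algebra borel) \<and>
    (\<forall>\<eta>. P 0 \<eta> = return borel \<eta>) \<and>
    (\<forall>s\<ge>0. \<forall>t\<ge>0. \<forall>\<eta>. P (s + t) \<eta> = P s \<eta> \<bind> P t) \<and>
    (\<forall>t\<ge>0. \<forall>f :: 'a \<Rightarrow>\<^sub>C real. continuous_on UNIV (\<lambda>\<eta>. \<integral>\<zeta>. f \<zeta> \<partial>P t \<eta>)) \<and>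
    (\<forall>f :: 'a \<Rightarrow>\<^sub>C real. uniform_limit UNIV (\<lambda>t \<eta>. \<integral>\<zeta>. f \<zeta> \<partial>P t \<eta>) f (at_right 0))"

definition semigroup_op ::
    "(real \<Rightarrow> 'a::topological_space \<Rightarrow> 'a measure) \<Rightarrow> real \<Rightarrow> ('a \<Rightarrow>\<^sub>C real) \<Rightarrow> ('a \<Rightarrow>\<^sub>C real)" where
  "semigroup_op P t f = Bcontfun (\<lambda>\<eta>. \<integral>\<zeta>. f \<zeta> \<partial>P t \<eta>)"

text \<open>Unbounded operators on \<^typ>\<open>'a \<Rightarrow>\<^sub>C real\<close> are represented by their graphs; the closure of an
  operator is the topological closure of its graph.\<close>

definition generator ::
    "(real \<Rightarrow> 'a::topological_space \<Rightarrow> 'a measure) \<Rightarrow> (('a \<Rightarrow>\<^sub>C real) \<times> ('a \<Rightarrow>\<^sub>C real)) set" where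
  "generator P = {(f, g). ((\<lambda>t. (1 / t) *\<^sub>R (semigroup_op P t f - f)) \<longlongrightarrow> g) (at_right 0)}"

definition natural_filtration ::
    "'w measure \<Rightarrow> (real \<Rightarrow> 'w \<Rightarrow> 'a::topological_space) \<Rightarrow> real \<Rightarrow> 'w measure" where
  "natural_filtration M \<xi> s =
    sigma (space M) (\<Union>u\<in>{0..s}. {\<xi> u -` A \<inter> space M | A. A \<in> sets borel})"

definition markov_process ::
    "(real \<Rightarrow> 'a::topological_space \<Rightarrow> 'a measure) \<Rightarrow> 'w measure \<Rightarrow> (real \<Rightarrow> 'w \<Rightarrow> 'a) \<Rightarrow> bool" where
  "markov_process P M \<xi> \<longleftrightarrow>
    prob_space M \<and>
    (\<forall>t\<ge>0. \<xi> t \<in> M \<rightarrow>\<^sub>M borel) \<and>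
    (\<forall>s\<ge>0. \<forall>t\<ge>0. \<forall>A\<in>sets borel. AE \<omega> in M.
      real_cond_exp M (natural_filtration M \<xi> s) (\<lambda>\<omega>. indicator A (\<xi> (s + t) \<omega>)) \<omega>
        = measure (P t (\<xi> s \<omega>)) A)"

definition cylinder_function :: "(config \<Rightarrow> real) \<Rightarrow> bool" where
  "cylinder_function f \<longleftrightarrow>
    (\<exists>A. finite A \<and> (\<forall>\<eta> \<zeta>. (\<forall>x\<in>A. \<eta> x = \<zeta> x) \<longrightarrow> f \<eta> = f \<zeta>))"

text \<open>For a cylinder function only finitely many summands below are nonzero.\<close>

definition spin_pregenerator ::
    "(int \<Rightarrow> config \<Rightarrow> real) \<Rightarrow> ((config \<Rightarrow>\<^sub>C real) \<times> (config \<Rightarrow>\<^sub>C real)) set" where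
  "spin_pregenerator c =
    {(f :: config \<Rightarrow>\<^sub>C real, g :: config \<Rightarrow>\<^sub>C real). cylinder_function f \<and>
      (\<forall>\<eta>. g \<eta> = (\<Sum>\<^sub>\<infinity>x\<in>UNIV. c x \<eta> * (f (flip x \<eta>) - f \<eta>)))}"

definition spin_system ::
    "(int \<Rightarrow> config \<Rightarrow> real) \<Rightarrow> (real \<Rightarrow> config \<Rightarrow> config measure) \<Rightarrow> bool" where
  "spin_system c P \<longleftrightarrow> feller_kernel P \<and> generator P = closure (spin_pregenerator c)"

definition stoch_le ::
    "'a::{order,topological_space} measure \<Rightarrow> 'a measure \<Rightarrow> bool" where
  "stoch_le \<mu> \<nu> \<longleftrightarrow>
    (\<forall>f :: 'a \<Rightarrow> real. f \<in> borel_measurable borel \<and> bounded (range f) \<and> mono f \<longrightarrow>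
      (\<integral>\<eta>. f \<eta> \<partial>\<mu>) \<le> (\<integral>\<eta>. f \<eta> \<partial>\<nu>))"

definition stoch_decreasing :: "(nat \<Rightarrow> 'a::{order,topological_space} measure) \<Rightarrow> bool" where
  "stoch_decreasing \<nu> \<longleftrightarrow> (\<forall>n. stoch_le (\<nu> (Suc n)) (\<nu> n))"

text \<open>\<open>\<mu> \<bind> P t\<close> is the law at time \<open>t\<close> of the process with initial law \<open>\<mu>\<close>.\<close>

definition attractive ::
    "(real \<Rightarrow> 'a::{order,topological_space} \<Rightarrow> 'a measure) \<Rightarrow> bool" where
  "attractive P \<longleftrightarrow>
    (\<forall>\<mu>\<^sub>1\<in>space (prob_algebra borel). \<forall>\<mu>\<^sub>2\<in>space (prob_algebra borel).
      stoch_le \<mu>\<^sub>1 \<mu>\<^sub>2 \<longrightarrow> (\<forall>t\<ge>0. stoch_le (\<mu>\<^sub>1 \<bind> P t) (\<mu>\<^sub>2 \<bind> P t)))"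

definition law_from ::
    "'w measure \<Rightarrow> (real \<Rightarrow> 'w \<Rightarrow> config) \<Rightarrow> real \<Rightarrow> nat \<Rightarrow> (nat \<Rightarrow> bool) measure" where
  "law_from M \<xi> t z = distr M borel (\<lambda>\<omega> n. \<xi> t \<omega> (int z + int n))"

end

theory Submission
  imports Defs
begin

text \<open>The law of the process seen from site 1 is its law when started from
  \<open>shift 1 1\<^bsub>(-\<infinity>,0]\<^esub> = 1\<^bsub>(-\<infinity>,-1]\<^esub> \<le> 1\<^bsub>(-\<infinity>,0]\<^esub>\<close>, so attractiveness gives the comparison once the
  semigroup \<open>S\<close> is known to commute with the operator \<open>U f = f \<circ> shift a\<close>. The pregenerator commutes
  with \<open>U\<close>, hence so does its closure, the generator. For \<open>f\<close> in the domain, the path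
  \<open>\<phi> s = S (t - s) (U (S s f))\<close> therefore has right derivative 0 and is constant, that is,
  \<open>U (S t f) = S t (U f)\<close>; cylinder functions lie in the domain and determine measures.\<close>

section \<open>Functions with vanishing right derivative\<close>

text \<open>Continuous induction: for each \<open>\<epsilon> > 0\<close> the bound
  \<open>norm (\<phi> s - \<phi> a) \<le> \<epsilon> * (s - a)\<close> survives limits by continuity
  and extends a little to the right by the derivative condition, so it reaches \<open>b\<close>;
  then \<open>\<epsilon>\<close> tends to 0.\<close>

lemma eq_of_right_derivative_zero:
  fixes \<phi> :: "real \<Rightarrow> 'b::real_normed_vector"
  assumes "a \<le> b" and cont: "continuous_on {a..b} \<phi>"
    and deriv: "\<And>s. a \<le> s \<Longrightarrow> s < b \<Longrightarrow>
      ((\<lambda>h. (1 / h) *\<^sub>R (\<phi> (s + h) - \<phi> s)) \<longlongrightarrow> 0) (at_right 0)"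
  shows "\<phi> b = \<phi> a"
proof -
  have bound: "norm (\<phi> b - \<phi> a) \<le> \<epsilon> * (b - a)" if "\<epsilon> > 0" for \<epsilon> :: real
  proof -
    \<comment> \<open>The bound is phrased as membership in the closed set \<open>{..0}\<close>, so
      that \<open>A\<close> is a closed preimage. \<open>C\<close> holds the right ends of initial
      segments on which the bound is valid throughout.\<close>
    define A where "A = {s\<in>{a..b}. norm (\<phi> s - \<phi> a) - \<epsilon> * (s - a) \<in> {..0}}"
    define C where "C = {s\<in>{a..b}. {a..s} \<subseteq> A}"
    define m where "m = Sup C"
    have "closed A"
      unfolding A_def
      by (rule continuous_closed_preimage[unfolded vimage_def Int_def, simplified])
        (use cont in \<open>auto intro!: continuous_intros continuous_closed_preimage\<close>)
    have aC: "a \<in> C" using \<open>a \<le> b\<close> by (auto simp: C_def A_def)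
    have bdd: "bdd_above C" by (rule bdd_aboveI[of _ b]) (auto simp: C_def)
    have CA: "C \<subseteq> A" by (auto simp: C_def)
    have "m \<in> closure C" unfolding m_def using aC bdd by (intro closure_contains_Sup) auto
    then have mA: "m \<in> A" using CA \<open>closed A\<close> by (meson closure_minimal subsetD)
    then have m: "a \<le> m" "m \<le> b" by (auto simp: A_def)
    have below: "{a..m} \<subseteq> A"
    proof
      fix r assume r: "r \<in> {a..m}"
      show "r \<in> A"
      proof (cases "r = m")
        case False
        then have "r < Sup C" using r by (auto simp: m_def)
        then obtain c where "c \<in> C" "r < c" using aC less_cSupD[of C r] by auto
        then show ?thesis using r by (auto simp: C_def)
      qed (use mA in simp)
    qed
    have "m = b"
    proof (rule ccontr)
      assume "m \<noteq> b"
      then have "m < b" using m by simp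
      from tendstoD[OF deriv[OF m(1) this] \<open>\<epsilon> > 0\<close>]
      have "\<forall>\<^sub>F h in at_right 0. norm ((1 / h) *\<^sub>R (\<phi> (m + h) - \<phi> m)) < \<epsilon>" by simp
      then obtain \<delta> where \<delta>: "\<delta> > 0"
        "\<And>h. 0 < h \<Longrightarrow> h < \<delta> \<Longrightarrow> norm ((1 / h) *\<^sub>R (\<phi> (m + h) - \<phi> m)) < \<epsilon>"
        by (auto simp: eventually_at_right_field)
      \<comment> \<open>Halving \<open>\<delta>\<close> makes the estimate available up to and
        including \<open>m + d\<close>; the other bound keeps \<open>m + d\<close> inside the
        interval.\<close>
      define d where "d = min (\<delta> / 2) (b - m)"
      have d: "0 < d" "d < \<delta>" "m + d \<le> b" using \<delta>(1) \<open>m < b\<close> by (auto simp: d_def)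
      have "r \<in> A" if r: "m < r" "r \<le> m + d" for r
      proof -
        have "norm (\<phi> (m + (r - m)) - \<phi> m) \<le> \<epsilon> * (r - m)"
          using \<delta>(2)[of "r - m"] r d by (simp add: divide_simps mult.commute)
        moreover have "norm (\<phi> m - \<phi> a) \<le> \<epsilon> * (m - a)" using mA by (simp add: A_def)
        ultimately have "norm (\<phi> r - \<phi> a) \<le> \<epsilon> * (r - m) + \<epsilon> * (m - a)"
          using norm_triangle_ineq[of "\<phi> r - \<phi> m" "\<phi> m - \<phi> a"] by simp
        then show ?thesis using r d m by (simp add: A_def algebra_simps)
      qed
      then have "m + d \<in> C" using below m d by (force simp: C_def)
      then have "m + d \<le> m" unfolding m_def using bdd by (rule cSup_upper)
      then show False using d by simp
    qed
    then show ?thesis using mA by (simp add: A_def)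
  qed
  show ?thesis
  proof (cases "a = b")
    case False
    \<comment> \<open>The slope \<open>e / (b - a)\<close> makes the accumulated error over the
      interval exactly \<open>e\<close>.\<close>
    have "norm (\<phi> b - \<phi> a) \<le> 0 + e" if "e > 0" for e
      using bound[of "e / (b - a)"] that \<open>a \<le> b\<close> False by simp
    then have "norm (\<phi> b - \<phi> a) \<le> 0" by (rule field_le_epsilon)
    then show ?thesis by simp
  qed simp
qed

section \<open>Strongly continuous contraction semigroups\<close>

locale contraction_semigroup =
  fixes S :: "real \<Rightarrow> 'b::real_normed_vector \<Rightarrow> 'b"
  assumes linear: "t \<ge> 0 \<Longrightarrow> linear (S t)"
    and contraction: "t \<ge> 0 \<Longrightarrow> norm (S t f) \<le> norm f"
    and zero: "S 0 f = f"
    and add: "s \<ge> 0 \<Longrightarrow> t \<ge> 0 \<Longrightarrow> S (s + t) f = S s (S t f)"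
    and right_continuous: "((\<lambda>t. S t f) \<longlongrightarrow> f) (at_right 0)"
begin

definition gen :: "('b \<times> 'b) set" where
  "gen = {(f, g). ((\<lambda>t. (1 / t) *\<^sub>R (S t f - f)) \<longlongrightarrow> g) (at_right 0)}"

lemmas diff = linear_diff[OF linear] and scale = linear_scale[OF linear]

lemma bounded_linear: "t \<ge> 0 \<Longrightarrow> bounded_linear (S t)"
  using contraction[of t]
  by (intro bounded_linear_intro[where K = 1]) (auto simp: linear_add linear_scale linear)

text \<open>\<open>S s\<close> is continuous, linear and commutes with \<open>S h\<close>, so it can
  be applied to the difference quotients of \<open>f\<close>.\<close>

lemma gen_invariant:
  assumes "(f, g) \<in> gen" "s \<ge> 0"
  shows "(S s f, S s g) \<in> gen"
proof -
  have "((\<lambda>h. S s ((1 / h) *\<^sub>R (S h f - f))) \<longlongrightarrow> S s g) (at_right 0)"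
    using assms by (intro bounded_linear.tendsto[OF bounded_linear]) (auto simp: gen_def)
  moreover have "\<forall>\<^sub>F h in at_right 0. S s ((1 / h) *\<^sub>R (S h f - f)) = (1 / h) *\<^sub>R (S h (S s f) - S s f)"
    using eventually_at_right_less
  proof eventually_elim
    case (elim h)
    then have "S s (S h f) = S h (S s f)"
      using assms add[of s h] add[of h s] by (simp add: add.commute)
    then show ?case using assms by (simp add: diff scale)
  qed
  ultimately show ?thesis by (auto simp: gen_def dest: Lim_transform_eventually)
qed

text \<open>The semigroup at the smaller time factors out and is a contraction. This carries right
  continuity at 0 to two-sided continuity at all later times.\<close>

lemma dist_le:
  assumes "s \<ge> 0" "t \<ge> 0"
  shows "norm (S s f - S t f) \<le> norm (S \<bar>s - t\<bar> f - f)"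
proof -
  have *: "norm (S s f - S t f) \<le> norm (S (s - t) f - f)" if "0 \<le> t" "t \<le> s" for s t
    using add[of t "s - t" f] that contraction[of t "S (s - t) f - f"] by (simp add: diff)
  show ?thesis
    proof (cases "t \<le> s")
    case False
    then have "\<bar>s - t\<bar> = t - s" by simp
    then show ?thesis using *[of s t] assms False by (simp add: norm_minus_commute[of "S s f"])
  qed (use * assms in simp)
qed

lemma continuous: "continuous_on {0..} (\<lambda>t. S t f)"
  unfolding continuous_on_iff
proof (intro ballI allI impI)
  fix s e :: real
  assume s: "s \<in> {0..}" and "0 < e"
  from tendstoD[OF right_continuous[of f] \<open>0 < e\<close>]
  obtain d where d: "d > 0" "\<And>h. 0 < h \<Longrightarrow> h < d \<Longrightarrow> norm (S h f - f) < e"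
    by (auto simp: eventually_at_right_field dist_norm)
  have "dist (S t f) (S s f) < e" if "t \<in> {0..}" "dist t s < d" for t
  proof -
    have "norm (S \<bar>t - s\<bar> f - f) < e"
      using d(2)[of "\<bar>t - s\<bar>"] that \<open>0 < e\<close> by (cases "t = s") (auto simp: zero dist_real_def)
    then show ?thesis using dist_le[of t s f] that s by (simp add: dist_norm)
  qed
  then show "\<exists>d>0. \<forall>t\<in>{0..}. dist t s < d \<longrightarrow> dist (S t f) (S s f) < e"
    using d(1) by blast
qed

text \<open>The operators have norm at most 1 uniformly in time, so the error
  \<open>S (r u) (x u - x s)\<close> vanishes, and \<open>S (r u) (x s)\<close> converges by
  continuity in time.\<close>

lemma continuous_on_apply:
  assumes r: "continuous_on A r" "\<And>s. s \<in> A \<Longrightarrow> r s \<ge> 0" and x: "continuous_on A x"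
  shows "continuous_on A (\<lambda>s. S (r s) (x s))"
  unfolding continuous_on_def
proof
  fix s assume s: "s \<in> A"
  have "continuous_on A (\<lambda>u. S (r u) (x s))"
    by (rule continuous_on_compose2[OF continuous r(1)]) (use r(2) in auto)
  then have 1: "((\<lambda>u. S (r u) (x s)) \<longlongrightarrow> S (r s) (x s)) (at s within A)"
    using s by (auto simp: continuous_on_def)
  have 2: "(x \<longlongrightarrow> x s) (at s within A)" using x s by (auto simp: continuous_on_def)
  have "((\<lambda>u. S (r u) (x u - x s)) \<longlongrightarrow> 0) (at s within A)"
  proof (rule Lim_null_comparison)
    show "\<forall>\<^sub>F u in at s within A. norm (S (r u) (x u - x s)) \<le> norm (x u - x s)"
      using r(2) by (auto simp: eventually_at_filter contraction intro: always_eventually)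
    show "((\<lambda>u. norm (x u - x s)) \<longlongrightarrow> 0) (at s within A)"
      using 2 by (simp add: LIM_zero tendsto_norm_zero)
  qed
  from tendsto_add[OF this 1]
  have lim: "((\<lambda>u. S (r u) (x u - x s) + S (r u) (x s)) \<longlongrightarrow> S (r s) (x s)) (at s within A)" by simp
  show "((\<lambda>u. S (r u) (x u)) \<longlongrightarrow> S (r s) (x s)) (at s within A)"
    by (rule Lim_transform_eventually[OF lim])
      (use r(2) in \<open>auto simp: eventually_at_filter diff intro: always_eventually\<close>)
qed

lemma commute:
  assumes U: "bounded_linear U" "\<And>f g. (f, g) \<in> gen \<Longrightarrow> (U f, U g) \<in> gen"
    and f: "(f, g) \<in> gen" and t: "t \<ge> 0"
  shows "U (S t f) = S t (U f)"
proof -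
  interpret U: bounded_linear U by fact
  \<comment> \<open>The endpoints are the two sides of the claim:
    \<open>\<phi> 0 = S t (U f)\<close> and \<open>\<phi> t = U (S t f)\<close>.\<close>
  define \<phi> where "\<phi> s = S (t - s) (U (S s f))" for s
  have "continuous_on {0..t} (\<lambda>s. S s f)"
    by (rule continuous_on_subset[OF continuous]) auto
  then have "continuous_on {0..t} \<phi>"
    unfolding \<phi>_def by (intro continuous_on_apply continuous_intros U.continuous_on) auto
  moreover have "((\<lambda>h. (1 / h) *\<^sub>R (\<phi> (s + h) - \<phi> s)) \<longlongrightarrow> 0) (at_right 0)" if s: "0 \<le> s" "s < t" for s
  proof -
    define k where "k = S s f"
    define l where "l = S s g"
    \<comment> \<open>\<open>D h\<close> compares \<open>U\<close> applied to the difference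
      quotient at \<open>k\<close> with the difference quotient at \<open>U k\<close>. Both tend to
      \<open>U l\<close>, because \<open>U\<close> preserves the graph of the generator.\<close>
    define D where "D h = U ((1 / h) *\<^sub>R (S h k - k)) - (1 / h) *\<^sub>R (S h (U k) - U k)" for h
    have kl: "(k, l) \<in> gen" unfolding k_def l_def using f s(1) by (rule gen_invariant)
    then have "((\<lambda>h. (1 / h) *\<^sub>R (S h k - k)) \<longlongrightarrow> l) (at_right 0)"
      "((\<lambda>h. (1 / h) *\<^sub>R (S h (U k) - U k)) \<longlongrightarrow> U l) (at_right 0)"
      using U(2)[OF kl] by (auto simp: gen_def)
    then have "(D \<longlongrightarrow> U l - U l) (at_right 0)"
      unfolding D_def by (intro tendsto_diff U.tendsto)
    then have "((\<lambda>h. norm (D h)) \<longlongrightarrow> 0) (at_right 0)" by (simp add: tendsto_norm_zero)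
    moreover have "\<forall>\<^sub>F h in at_right 0. norm ((1 / h) *\<^sub>R (\<phi> (s + h) - \<phi> s)) \<le> norm (D h)"
      using eventually_at_right_real[OF diff_gt_0_iff_gt[THEN iffD2, OF s(2)]]
    proof eventually_elim
      case (elim h)
      then have h: "0 < h" "h < t - s" by auto
      have D: "D h = (1 / h) *\<^sub>R (U (S h k) - S h (U k))"
        unfolding D_def U.scaleR U.diff scaleR_diff_right by simp
      \<comment> \<open>Both values carry the outer factor \<open>S (t - (s + h))\<close>, a
        contraction since \<open>h < t - s\<close>; hence the quotient of \<open>\<phi>\<close> is
        no larger than \<open>D h\<close>.\<close>
      have "\<phi> (s + h) = S (t - (s + h)) (U (S h k))"
        "\<phi> s = S (t - (s + h)) (S h (U k))"
        using add[of h s f, unfolded add.commute[of h s]] add[of "t - (s + h)" h "U k"] h s unfolding \<phi>_def k_def by auto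
      then have "(1 / h) *\<^sub>R (\<phi> (s + h) - \<phi> s) = S (t - (s + h)) (D h)"
        using h unfolding D by (simp only: diff scale)
      then show ?case using contraction[of "t - (s + h)" "D h"] h by simp
    qed
    ultimately show ?thesis by (rule Lim_null_comparison[rotated])
  qed
  ultimately have "\<phi> t = \<phi> 0" by (intro eq_of_right_derivative_zero t)
  then show ?thesis by (simp add: \<phi>_def zero)
qed

end

section \<open>Feller kernels as contraction semigroups\<close>

lemma apply_Bcontfun:
  fixes f :: "'a::topological_space \<Rightarrow> 'b::real_normed_vector"
  assumes "continuous_on UNIV f" "\<And>x. norm (f x) \<le> B"
  shows "apply_bcontfun (Bcontfun f) x = f x"
  using bcontfun_normI[OF assms] by (simp add: Bcontfun_inverse)

lemma bcontfun_measurable [measurable]: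
  fixes f :: "'a::topological_space \<Rightarrow>\<^sub>C real"
  shows "apply_bcontfun f \<in> borel_measurable borel"
  by (intro borel_measurable_continuous_onI) simp

lemma integrable_bcontfun:
  fixes f :: "'a::topological_space \<Rightarrow>\<^sub>C real"
  assumes "prob_space M" "sets M = sets borel"
  shows "integrable M (apply_bcontfun f)"
proof -
  interpret prob_space M by fact
  show ?thesis
    using bcontfun_measurable[of f] norm_bounded[of f]
    by (intro integrable_const_bound[where B = "norm f"])
      (auto simp: measurable_cong_sets[OF assms(2) refl])
qed

locale feller =
  fixes P :: "real \<Rightarrow> 'a::topological_space \<Rightarrow> 'a measure"
  assumes feller: "feller_kernel P"
begin

lemma kernel: "t \<ge> 0 \<Longrightarrow> P t \<in> borel \<rightarrow>\<^sub>M prob_algebra borel"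
  using feller by (simp add: feller_kernel_def)

lemma kernel_subprob: "t \<ge> 0 \<Longrightarrow> P t \<in> borel \<rightarrow>\<^sub>M subprob_algebra borel"
  by (rule measurable_prob_algebraD[OF kernel])

lemma prob: "t \<ge> 0 \<Longrightarrow> prob_space (P t \<eta>)" and sets_kernel: "t \<ge> 0 \<Longrightarrow> sets (P t \<eta>) = sets borel"
  using measurable_space[OF kernel, of t \<eta>] by (auto simp: space_prob_algebra)

lemma integrable:
  fixes f :: "'a \<Rightarrow>\<^sub>C real"
  shows "t \<ge> 0 \<Longrightarrow> integrable (P t \<eta>) (apply_bcontfun f)"
  by (rule integrable_bcontfun[OF prob sets_kernel])

lemma norm_integral_le:
  fixes f :: "'a \<Rightarrow>\<^sub>C real"
  assumes "t \<ge> 0" shows "norm (\<integral>\<zeta>. apply_bcontfun f \<zeta> \<partial>P t \<eta>) \<le> norm f"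
proof -
  interpret prob_space "P t \<eta>" using assms by (rule prob)
  have "norm (\<integral>\<zeta>. f \<zeta> \<partial>P t \<eta>) \<le> (\<integral>\<zeta>. norm (f \<zeta>) \<partial>P t \<eta>)" by simp
  also have "\<dots> \<le> (\<integral>\<zeta>. norm f \<partial>P t \<eta>)"
    by (intro integral_mono integrable_norm integrable assms norm_bounded) simp
  finally show ?thesis by (simp add: prob_space)
qed

lemma semigroup_op_apply:
  assumes "t \<ge> 0" shows "apply_bcontfun (semigroup_op P t f) \<eta> = (\<integral>\<zeta>. f \<zeta> \<partial>P t \<eta>)"
  unfolding semigroup_op_def
  using feller assms
  by (intro apply_Bcontfun[OF _ norm_integral_le]) (auto simp: feller_kernel_def)

text \<open>Contraction comes from total mass 1, the semigroup law from Chapman-Kolmogorov, and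
  strong continuity from the uniform limit at time 0.\<close>

sublocale contraction_semigroup "semigroup_op P"
proof
  fix s t :: real and f g :: "'a \<Rightarrow>\<^sub>C real"
  fix r :: real
  show "semigroup_op P t (f + g) = semigroup_op P t f + semigroup_op P t g"
    "semigroup_op P t (r *\<^sub>R f) = r *\<^sub>R semigroup_op P t f" if "t \<ge> 0"
    using that integrable[OF that] by (auto intro!: bcontfun_eqI simp: semigroup_op_apply)
  show "norm (semigroup_op P t f) \<le> norm f" if "t \<ge> 0"
    using norm_integral_le that by (intro norm_bound) (simp add: semigroup_op_apply)
  show "semigroup_op P 0 f = f"
    using feller by (intro bcontfun_eqI) (simp add: semigroup_op_apply feller_kernel_def integral_return)
  show "semigroup_op P (s + t) f = semigroup_op P s (semigroup_op P t f)" if s: "s \<ge> 0" and t: "t \<ge> 0"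
  proof (rule bcontfun_eqI)
    fix \<eta>
    \<comment> \<open>Fubini for kernels: integrating against the composed kernel is iterated
      integration.\<close>
    have "(\<integral>\<zeta>. f \<zeta> \<partial>(P s \<eta> \<bind> P t)) = (\<integral>\<zeta>. (\<integral>\<theta>. f \<theta> \<partial>P t \<zeta>) \<partial>P s \<eta>)"
    proof (rule integral_bind[where K = borel and B = "norm f" and B' = 1])
      show "P t \<in> P s \<eta> \<rightarrow>\<^sub>M subprob_algebra borel"
        using kernel_subprob[OF t] by (simp add: measurable_cong_sets[OF sets_kernel[OF s] refl])
      show "finite_measure (P s \<eta>)" using prob[OF s] by (simp add: prob_space.finite_measure)
      show "AE \<zeta> in P s \<eta>. emeasure (P t \<zeta>) (space (P t \<zeta>)) \<le> ennreal 1"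
        using prob[OF t] by (simp add: prob_space.emeasure_space_1)
    qed (use norm_bounded[of f] in auto)
    then show "semigroup_op P (s + t) f \<eta> = semigroup_op P s (semigroup_op P t f) \<eta>"
      using feller s t by (simp add: semigroup_op_apply feller_kernel_def)
  qed
  \<comment> \<open>Operator and kernel integral are known to agree only for
    \<open>t \<ge> 0\<close>, which holds eventually at the right of 0.\<close>
  have "uniform_limit UNIV (\<lambda>t. apply_bcontfun (semigroup_op P t f)) f (at_right 0)"
    using feller
    by (subst uniform_limit_cong[where g = "\<lambda>t \<eta>. \<integral>\<zeta>. f \<zeta> \<partial>P t \<eta>" and i = f])
      (auto simp: feller_kernel_def semigroup_op_apply intro: eventually_mono[OF eventually_at_right_less])
  then show "((\<lambda>t. semigroup_op P t f) \<longlongrightarrow> f) (at_right 0)"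
    by (rule uniform_limit_tendsto_bcontfun)
qed

lemma gen_eq_generator: "gen = generator P"
  by (simp add: gen_def generator_def)

end

section \<open>Shifts, cylinder functions and the pregenerator\<close>

lemma continuous_shift: "continuous_on UNIV (shift a)"
  unfolding shift_def by (intro continuous_intros) simp

lemma measurable_shift [measurable]: "shift a \<in> borel \<rightarrow>\<^sub>M borel"
  by (intro borel_measurable_continuous_onI continuous_shift)

text \<open>This operator takes the role of \<open>U\<close> in \<open>commute\<close>.\<close>

definition shift_op :: "int \<Rightarrow> (config \<Rightarrow>\<^sub>C real) \<Rightarrow> (config \<Rightarrow>\<^sub>C real)" where
  "shift_op a f = Bcontfun (\<lambda>\<eta>. f (shift a \<eta>))"

lemma shift_op_apply [simp]: "shift_op a f \<eta> = f (shift a \<eta>)"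
  unfolding shift_op_def
  by (intro apply_Bcontfun[where B = "norm f"] norm_bounded
      continuous_on_compose2[OF continuous_on_apply_bcontfun continuous_shift]) auto

lemma bounded_linear_shift_op: "bounded_linear (shift_op a)"
proof (rule bounded_linear_intro[where K = 1])
  show "norm (shift_op a f) \<le> norm f * 1" for f
    by (rule norm_bound) (use norm_bounded[of f] in simp)
qed (auto intro!: bcontfun_eqI)

lemma cylinder_functionE:
  assumes "cylinder_function f"
  obtains A where "finite A" "\<And>\<eta> \<zeta>. (\<And>x. x \<in> A \<Longrightarrow> \<eta> x = \<zeta> x) \<Longrightarrow> f \<eta> = f \<zeta>"
proof -
  obtain A where "finite A" "\<forall>\<eta> \<zeta>. (\<forall>x\<in>A. \<eta> x = \<zeta> x) \<longrightarrow> f \<eta> = f \<zeta>"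
    using assms by (auto simp: cylinder_function_def)
  then show ?thesis by (intro that[of A]) simp_all
qed

text \<open>Bounded because there are finitely many patterns on a finite set of sites, and
  continuous because coordinates are discrete, which makes the function locally constant.\<close>

lemma cylinder_imp_bcontfun:
  assumes "cylinder_function f"
  shows "f \<in> bcontfun"
proof -
  obtain A where A: "finite A" "\<And>\<eta> \<zeta>. (\<And>x. x \<in> A \<Longrightarrow> \<eta> x = \<zeta> x) \<Longrightarrow> f \<eta> = f \<zeta>"
    using cylinder_functionE[OF assms] by metis
  \<comment> \<open>Setting \<open>\<eta>\<close> to 0 off \<open>A\<close> does not change the
    value of \<open>f\<close>.\<close>
  have "f \<eta> \<in> (\<lambda>B. f (\<lambda>x. x \<in> B)) ` Pow A" for \<eta>
    by (rule image_eqI[where x = "{x\<in>A. \<eta> x}"]) (auto intro: A(2))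
  then have "finite (range f)" using A(1)
    by (intro finite_subset[of "range f" "(\<lambda>B. f (\<lambda>x. x \<in> B)) ` Pow A"]) auto
  then have "bounded (range f)" by (rule finite_imp_bounded)
  moreover have "continuous_on UNIV f"
    unfolding continuous_on_def
  proof
    fix \<eta> :: config
    have "open (\<Inter>x\<in>A. (\<lambda>\<zeta>. \<zeta> x) -` {\<eta> x})"
      using A(1) by (intro open_INT ballI open_vimage continuous_on_product_coordinates discrete_topology_class.open_discrete)
    then have "\<forall>\<^sub>F \<zeta> in at \<eta>. \<zeta> \<in> (\<Inter>x\<in>A. (\<lambda>\<zeta>. \<zeta> x) -` {\<eta> x})"
      by (intro eventually_at_in_open') auto
    then have "\<forall>\<^sub>F \<zeta> in at \<eta>. f \<zeta> = f \<eta>"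
      by eventually_elim (auto intro: A(2))
    then show "(f \<longlongrightarrow> f \<eta>) (at \<eta>)" by (simp add: tendsto_eventually)
  qed
  ultimately show ?thesis by (simp add: bcontfun_def)
qed

lemma flip_shift: "flip x (shift a \<eta>) = shift a (flip (a + x) \<eta>)"
  by (auto simp: flip_def shift_def)

text \<open>By translation invariance, site \<open>x\<close> of the shifted configuration behaves as
  site \<open>a + x\<close> of the original; the sum over all sites is then reindexed.\<close>

lemma spin_pregenerator_shift:
  assumes c: "translation_invariant c" and fg: "(f, g) \<in> spin_pregenerator c"
  shows "(shift_op a f, shift_op a g) \<in> spin_pregenerator c"
proof -
  obtain A where A: "finite A" "\<And>\<eta> \<zeta>. (\<And>x. x \<in> A \<Longrightarrow> \<eta> x = \<zeta> x) \<Longrightarrow> f \<eta> = f \<zeta>"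
    using fg by (auto simp: spin_pregenerator_def elim: cylinder_functionE)
  have "cylinder_function (shift_op a f)"
    unfolding cylinder_function_def
    \<comment> \<open>Coordinate \<open>x\<close> of \<open>shift a \<eta>\<close> is coordinate
      \<open>a + x\<close> of \<open>\<eta>\<close>.\<close>
    by (rule exI[where x = "(+) a ` A"]) (auto simp: A(1) shift_def intro!: A(2))
  moreover have "shift_op a g \<eta> = (\<Sum>\<^sub>\<infinity>x. c x \<eta> * (shift_op a f (flip x \<eta>) - shift_op a f \<eta>))" for \<eta>
  proof -
    have c': "c x (shift a \<eta>) = c (a + x) \<eta>" for x
    proof -
      have "c x (shift a \<eta>) = c 0 (shift x (shift a \<eta>))" using c unfolding translation_invariant_def by blast
      also have "shift x (shift a \<eta>) = shift (a + x) \<eta>" by (auto simp: shift_def add.assoc)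
      also have "c 0 \<dots> = c (a + x) \<eta>" using c unfolding translation_invariant_def by metis
      finally show ?thesis .
    qed
    have "shift_op a g \<eta> = (\<Sum>\<^sub>\<infinity>x. c (a + x) \<eta> * (shift_op a f (flip (a + x) \<eta>) - shift_op a f \<eta>))"
      using fg by (simp add: spin_pregenerator_def c' flip_shift)
    also have "\<dots> = (\<Sum>\<^sub>\<infinity>x. c x \<eta> * (shift_op a f (flip x \<eta>) - shift_op a f \<eta>))"
      by (rule infsum_reindex_bij_betw) simp
    finally show ?thesis .
  qed
  ultimately show ?thesis by (simp add: spin_pregenerator_def)
qed

text \<open>The shift acts continuously on pairs, so invariance of the graph passes to its closure,
  which for a spin system is the generator.\<close>

lemma closure_spin_pregenerator_shift:
  assumes "translation_invariant c" "(f, g) \<in> closure (spin_pregenerator c)"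
  shows "(shift_op a f, shift_op a g) \<in> closure (spin_pregenerator c)"
proof -
  let ?U = "\<lambda>p. (shift_op a (fst p), shift_op a (snd p))"
  have "?U ` closure (spin_pregenerator c) \<subseteq> closure (spin_pregenerator c)"
  proof (rule image_closure_subset)
    show "continuous_on (closure (spin_pregenerator c)) ?U"
      by (intro continuous_intros bounded_linear.continuous_on[OF bounded_linear_shift_op])
    show "?U ` spin_pregenerator c \<subseteq> closure (spin_pregenerator c)"
      using spin_pregenerator_shift[OF assms(1)] closure_subset by fastforce
  qed simp
  then show ?thesis using assms(2) by force
qed

text \<open>Flips outside the support of \<open>f\<close> contribute nothing, and finite range makes
  the remaining finite sum a cylinder function. Its continuity is what membership in the
  pregenerator requires.\<close>

lemma cylinder_in_pregenerator_domain:
  assumes c: "finite_range c" and f: "cylinder_function (apply_bcontfun f)"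
  obtains g where "(f, g) \<in> spin_pregenerator c"
proof -
  obtain A where A: "finite A" "\<And>\<eta> \<zeta>. (\<And>x. x \<in> A \<Longrightarrow> \<eta> x = \<zeta> x) \<Longrightarrow> f \<eta> = f \<zeta>"
    using cylinder_functionE[OF f] by metis
  obtain N where "\<forall>x. finite (N x) \<and>
      (\<forall>\<eta> \<zeta>. (\<forall>y\<in>insert x (N x). \<eta> y = \<zeta> y) \<longrightarrow> c x \<eta> = c x \<zeta>)"
    using choice[OF c[unfolded finite_range_def]] by (rule exE)
  then have N: "finite (N x)"
    "\<And>\<eta> \<zeta>. (\<And>y. y \<in> insert x (N x) \<Longrightarrow> \<eta> y = \<zeta> y) \<Longrightarrow> c x \<eta> = c x \<zeta>" for x
    by simp_all
  define g where "g \<eta> = (\<Sum>\<^sub>\<infinity>x. c x \<eta> * (f (flip x \<eta>) - f \<eta>))" for \<eta>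
  have g: "g \<eta> = (\<Sum>x\<in>A. c x \<eta> * (f (flip x \<eta>) - f \<eta>))" for \<eta>
  proof -
    have "f (flip x \<eta>) = f \<eta>" if "x \<notin> A" for x
      using that by (intro A(2)) (auto simp: flip_def)
    then have "g \<eta> = (\<Sum>\<^sub>\<infinity>x\<in>A. c x \<eta> * (f (flip x \<eta>) - f \<eta>))"
      unfolding g_def by (intro infsum_cong_neutral) auto
    then show ?thesis using A(1) by simp
  qed
  have "cylinder_function g"
    unfolding cylinder_function_def
  \<comment> \<open>\<open>A\<close> covers the dependence through \<open>f\<close> and through each
    rate's own site; the sets \<open>N x\<close> cover the other coordinates of the rates.\<close>
  proof (intro exI[where x = "A \<union> (\<Union>x\<in>A. N x)"] conjI allI impI)
    fix \<eta> \<zeta> :: config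
    assume eq: "\<forall>x\<in>A \<union> (\<Union>x\<in>A. N x). \<eta> x = \<zeta> x"
    have "c x \<eta> = c x \<zeta>" "f (flip x \<eta>) = f (flip x \<zeta>)" "f \<eta> = f \<zeta>" if "x \<in> A" for x
      using eq that by (auto intro!: N(2) A(2) simp: flip_def)
    then show "g \<eta> = g \<zeta>" by (simp add: g)
  qed (use A(1) N(1) in auto)
  then have "apply_bcontfun (Bcontfun g) = g"
    using cylinder_imp_bcontfun by (simp add: Bcontfun_inverse)
  then have "(f, Bcontfun g) \<in> spin_pregenerator c"
    using f by (simp add: spin_pregenerator_def g_def)
  then show ?thesis by (rule that)
qed

section \<open>Cylinder functions determine measures\<close>

text \<open>Allows \<open>sets_PiM_equal_borel\<close> to identify the Borel and product
  sigma-algebras on configurations.\<close>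

instance bool :: second_countable_topology
proof
  show "\<exists>B :: bool set set. countable B \<and> open = generate_topology B"
    using open_bool_def by blast
qed

text \<open>Finite-dimensional boxes determine a finite measure on the product, and their indicators
  are cylinder functions.\<close>

lemma measure_eqI_cylinder:
  fixes \<mu> \<nu> :: "config measure"
  assumes "prob_space \<mu>" "prob_space \<nu>" and sets: "sets \<mu> = sets borel" "sets \<nu> = sets borel"
    and eq: "\<And>f. cylinder_function f \<Longrightarrow> (\<integral>\<eta>. f \<eta> \<partial>\<mu>) = (\<integral>\<eta>. f \<eta> \<partial>\<nu>)"
  shows "\<mu> = \<nu>"
proof (rule measure_eqI_PiM_infinite[where I = UNIV and M = "\<lambda>_. borel"])
  have PiM: "sets (Pi\<^sub>M UNIV (\<lambda>_::int. borel :: bool measure)) = sets borel"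
    by (rule sets_PiM_equal_borel)
  interpret \<mu>: prob_space \<mu> by fact
  interpret \<nu>: prob_space \<nu> by fact
  show "finite_measure \<mu>" by unfold_locales
  show "sets \<mu> = sets (Pi\<^sub>M UNIV (\<lambda>_. borel))" "sets \<nu> = sets (Pi\<^sub>M UNIV (\<lambda>_. borel))"
    by (simp_all only: sets PiM)
  fix A :: "int \<Rightarrow> bool set" and J :: "int set"
  assume J: "finite J" and A: "\<And>i. i \<in> J \<Longrightarrow> A i \<in> sets borel"
  let ?E = "prod_emb UNIV (\<lambda>_. borel) J (Pi\<^sub>E J A)"
  have E: "?E \<in> sets borel"
    using sets_PiM_I[of J UNIV A "\<lambda>_. borel"] J A by (simp add: PiM)
  have "cylinder_function (indicator ?E :: config \<Rightarrow> real)"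
    unfolding cylinder_function_def
    by (rule exI[where x = J]) (auto simp: J indicator_def prod_emb_iff PiE_iff)
  from eq[OF this] have "measure \<mu> ?E = measure \<nu> ?E"
    using E sets by (simp add: integral_indicator sets_eq_imp_space_eq[OF sets(1)] sets_eq_imp_space_eq[OF sets(2)])
  then show "emeasure \<mu> ?E = emeasure \<nu> ?E"
    by (simp add: \<mu>.emeasure_eq_measure \<nu>.emeasure_eq_measure)
qed

section \<open>Shift covariance and the law of the process\<close>

text \<open>Instance of \<open>commute\<close> with \<open>shift_op a\<close>: evaluated at
  \<open>\<eta>\<close>, the operator identity equates the integrals of every cylinder function
  under the two measures.\<close>

lemma spin_system_shift:
  assumes "translation_invariant c" "finite_range c" and P: "spin_system c P" and t: "t \<ge> 0"
  shows "P t (shift a \<eta>) = distr (P t \<eta>) borel (shift a)"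
proof -
  interpret feller P using P by unfold_locales (simp add: spin_system_def)
  have gen: "gen = closure (spin_pregenerator c)"
    using P by (simp add: spin_system_def gen_eq_generator)
  have [measurable]: "shift a \<in> P t \<eta> \<rightarrow>\<^sub>M borel"
    by (simp add: measurable_cong_sets[OF sets_kernel[OF t] refl])
  show ?thesis
  proof (rule measure_eqI_cylinder)
    fix h :: "config \<Rightarrow> real"
    assume h: "cylinder_function h"
    define f where "f = Bcontfun h"
    have f: "apply_bcontfun f = h" using cylinder_imp_bcontfun[OF h] by (simp add: f_def Bcontfun_inverse)
    obtain g where "(f, g) \<in> spin_pregenerator c"
      using cylinder_in_pregenerator_domain[OF assms(2), of f] h f by auto
    then have "(f, g) \<in> gen" using closure_subset gen by auto
    then have "shift_op a (semigroup_op P t f) = semigroup_op P t (shift_op a f)"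
      using closure_spin_pregenerator_shift[OF assms(1)] t gen
      by (intro commute[OF bounded_linear_shift_op]) auto
    then have "shift_op a (semigroup_op P t f) \<eta> = semigroup_op P t (shift_op a f) \<eta>" by simp
    then have "(\<integral>\<zeta>. f \<zeta> \<partial>P t (shift a \<eta>)) = (\<integral>\<zeta>. f (shift a \<zeta>) \<partial>P t \<eta>)"
      using t by (simp add: semigroup_op_apply)
    also have "\<dots> = (\<integral>\<zeta>. f \<zeta> \<partial>distr (P t \<eta>) borel (shift a))"
      by (simp add: integral_distr)
    finally show "(\<integral>\<zeta>. h \<zeta> \<partial>P t (shift a \<eta>)) = (\<integral>\<zeta>. h \<zeta> \<partial>distr (P t \<eta>) borel (shift a))"
      by (simp add: f)
  qed (use prob[OF t] t in \<open>auto simp: sets_kernel intro: prob_space.prob_space_distr\<close>)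
qed

text \<open>The Markov property at \<open>s = 0\<close> makes the conditional probability of
  \<open>\<xi> t \<in> A\<close> almost surely the constant \<open>measure (P t \<eta>) A\<close>;
  taking expectations removes the conditioning.\<close>

lemma markov_process_law:
  assumes P: "feller_kernel P" and \<xi>: "markov_process P M \<xi>"
    and start: "AE \<omega> in M. \<xi> 0 \<omega> = \<eta>" and t: "t \<ge> 0"
  shows "distr M borel (\<xi> t) = P t \<eta>"
proof (rule measure_eqI)
  interpret feller P by unfold_locales fact
  interpret prob_space M using \<xi> by (simp add: markov_process_def)
  have meas: "\<xi> u \<in> M \<rightarrow>\<^sub>M borel" if "u \<ge> 0" for u
    using \<xi> that by (simp add: markov_process_def)
  note [measurable] = meas[OF t]
  show "sets (distr M borel (\<xi> t)) = sets (P t \<eta>)" using t by (simp add: sets_kernel)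
  let ?F = "natural_filtration M \<xi> 0"
  have F: "subalgebra M ?F"
  proof -
    have "(\<Union>u\<in>{0..0}. {\<xi> u -` A \<inter> space M |A. A \<in> sets borel}) \<subseteq> sets M"
      using meas by (auto intro: measurable_sets)
    then show ?thesis
      unfolding subalgebra_def natural_filtration_def
      by (subst sets_measure_of) (auto simp: space_measure_of_conv dest: sets.sets_into_space intro!: sets.sigma_sets_subset)
  qed
  interpret F: finite_measure_subalgebra M ?F by unfold_locales fact
  fix A assume "A \<in> sets (distr M borel (\<xi> t))"
  then have [measurable]: "A \<in> sets borel" by simp
  interpret Pt: prob_space "P t \<eta>" using t by (rule prob)
  have "AE \<omega> in M. real_cond_exp M ?F (\<lambda>\<omega>. indicator A (\<xi> (0 + t) \<omega>)) \<omega> = measure (P t (\<xi> 0 \<omega>)) A"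
    using \<xi> t \<open>A \<in> sets borel\<close> unfolding markov_process_def by blast
  with start have "AE \<omega> in M. real_cond_exp M ?F (\<lambda>\<omega>. indicator A (\<xi> t \<omega>)) \<omega> = measure (P t \<eta>) A"
    by eventually_elim simp
  then have "(\<integral>\<omega>. real_cond_exp M ?F (\<lambda>\<omega>. indicator A (\<xi> t \<omega>)) \<omega> \<partial>M) = (\<integral>\<omega>. measure (P t \<eta>) A \<partial>M)"
    by (intro integral_cong_AE) auto
  moreover have "integrable M (\<lambda>\<omega>. indicator A (\<xi> t \<omega>) :: real)"
    by (intro integrable_const_bound[where B = 1]) auto
  ultimately have "(\<integral>\<omega>. indicator A (\<xi> t \<omega>) \<partial>M) = measure (P t \<eta>) A"
    using F.real_cond_exp_int(2) by (simp add: prob_space)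
  moreover have "(\<integral>\<omega>. indicator A (\<xi> t \<omega>) \<partial>M) = (\<integral>\<zeta>. indicator A \<zeta> \<partial>distr M borel (\<xi> t) :: real)"
    by (rule integral_distr[symmetric]) auto
  ultimately have "measure (distr M borel (\<xi> t)) A = measure (P t \<eta>) A"
    by simp
  then show "emeasure (distr M borel (\<xi> t)) A = emeasure (P t \<eta>) A"
    using prob_space_distr[OF meas[OF t]]
    by (simp add: Pt.emeasure_eq_measure prob_space.finite_measure finite_measure.emeasure_eq_measure)
qed

section \<open>Stochastic comparison\<close>

lemma stoch_le_return:
  fixes \<eta> \<zeta> :: "'a::{order,topological_space}"
  assumes "\<eta> \<le> \<zeta>" shows "stoch_le (return borel \<eta>) (return borel \<zeta>)"
  using assms by (auto simp: stoch_le_def integral_return mono_def)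

text \<open>Attractiveness applied to the point masses at \<open>\<eta>\<close> and
  \<open>\<zeta>\<close>.\<close>

lemma attractive_kernel_mono:
  assumes "feller_kernel P" "attractive P" "\<eta> \<le> \<zeta>" "t \<ge> 0"
  shows "stoch_le (P t \<eta>) (P t \<zeta>)"
proof -
  interpret feller P by unfold_locales fact
  have "return borel \<theta> \<bind> P t = P t \<theta>" for \<theta>
    by (rule bind_return[OF kernel_subprob[OF assms(4)]]) simp
  moreover have "return borel \<theta> \<in> space (prob_algebra borel)" for \<theta> :: 'a
    by (simp add: space_prob_algebra prob_space_return)
  ultimately show ?thesis
    using assms(2,4) stoch_le_return[OF assms(3)] unfolding attractive_def by metis
qed

theorem theorem1:
  fixes c :: "int \<Rightarrow> config \<Rightarrow> real"
    and P :: "real \<Rightarrow> config \<Rightarrow> config measure"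
    and M :: "'w measure"
    and \<xi> :: "real \<Rightarrow> 'w \<Rightarrow> config"
  assumes "\<And>x \<eta>. 0 \<le> c x \<eta>"
    and "bounded_rates c"
    and "translation_invariant c"
    and "finite_range c"
    and "spin_system c P"
    and "attractive P"
    and "markov_process P M \<xi>"
    and "AE \<omega> in M. \<xi> 0 \<omega> = (\<lambda>x. x \<le> 0)"
  shows "\<forall>t\<ge>0. stoch_decreasing (law_from M \<xi> t)"
proof (intro allI impI)
  fix t :: real
  assume t: "t \<ge> 0"
  define \<eta> :: config where "\<eta> = (\<lambda>x. x \<le> 0)"
  have feller: "feller_kernel P" using assms(5) by (simp add: spin_system_def)
  interpret feller P by unfold_locales fact
  have law: "distr M borel (\<xi> t) = P t \<eta>"
    using markov_process_law[OF feller assms(7,8) t] by (simp add: \<eta>_def)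
  have \<xi>: "\<xi> t \<in> M \<rightarrow>\<^sub>M borel" using assms(7) t by (simp add: markov_process_def)
  \<comment> \<open>\<open>shift 1 \<eta>\<close> occupies exactly the sites
    \<open>x \<le> -1\<close>. This single comparison of full configurations serves every
    \<open>z\<close>.\<close>
  have "shift 1 \<eta> \<le> \<eta>" by (auto simp: shift_def \<eta>_def le_fun_def)
  then have le: "stoch_le (P t (shift 1 \<eta>)) (P t \<eta>)"
    by (rule attractive_kernel_mono[OF feller assms(6) _ t])
  show "stoch_decreasing (law_from M \<xi> t)"
    unfolding stoch_decreasing_def stoch_le_def
  proof (intro allI impI, elim conjE)
    fix z :: nat and f :: "(nat \<Rightarrow> bool) \<Rightarrow> real"
    assume [measurable]: "f \<in> borel_measurable borel" and bdd: "bounded (range f)" and f: "mono f"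
    define r where "r \<zeta> = (\<lambda>n. \<zeta> (int z + int n))" for \<zeta> :: config
    have r [measurable]: "r \<in> borel \<rightarrow>\<^sub>M borel"
      unfolding r_def by (intro borel_measurable_continuous_onI continuous_intros) simp
    have shift: "shift 1 \<in> P t \<eta> \<rightarrow>\<^sub>M borel"
      by (simp add: measurable_cong_sets[OF sets_kernel[OF t] refl])
    \<comment> \<open>Reading from site \<open>z + 1\<close> is shifting by 1 and then reading from
      \<open>z\<close>; covariance moves that shift into the initial configuration.\<close>
    have "law_from M \<xi> t (Suc z) = distr (distr (distr M borel (\<xi> t)) borel (shift 1)) borel r"
    proof -
      have "r (shift 1 (\<xi> t \<omega>)) = (\<lambda>n. \<xi> t \<omega> (int (Suc z) + int n))" for \<omega>
        by (simp add: r_def shift_def algebra_simps)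
      then show ?thesis
        using \<xi> by (simp add: law_from_def distr_distr comp_def measurable_compose[OF _ measurable_shift])
    qed
    then have "(\<integral>\<zeta>. f \<zeta> \<partial>law_from M \<xi> t (Suc z)) = (\<integral>\<zeta>. f (r \<zeta>) \<partial>P t (shift 1 \<eta>))"
      by (simp add: law integral_distr spin_system_shift[OF assms(3,4,5) t])
    also have "\<dots> \<le> (\<integral>\<zeta>. f (r \<zeta>) \<partial>P t \<eta>)"
    proof -
      \<comment> \<open>\<open>f\<close> composed with the increasing restriction \<open>r\<close>
        is an admissible test function on full configurations.\<close>
      have "bounded (range (\<lambda>\<zeta>. f (r \<zeta>)))" by (rule bounded_subset[OF bdd]) auto
      moreover have "mono (\<lambda>\<zeta>. f (r \<zeta>))"
        using f by (auto simp: mono_def r_def le_fun_def)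
      ultimately show ?thesis using le by (simp add: stoch_le_def)
    qed
    also have "\<dots> = (\<integral>\<zeta>. f \<zeta> \<partial>law_from M \<xi> t z)"
    proof -
      have "law_from M \<xi> t z = distr M borel (\<lambda>\<omega>. r (\<xi> t \<omega>))"
        by (simp add: law_from_def r_def)
      then show ?thesis using \<xi> by (simp add: integral_distr flip: law)
    qed
    finally show "(\<integral>\<zeta>. f \<zeta> \<partial>law_from M \<xi> t (Suc z)) \<le> (\<integral>\<zeta>. f \<zeta> \<partial>law_from M \<xi> t z)" .
  qed
qed

end
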